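(* Let $(X, f_{1,\infty})$ be a $k$-periodic non-autonomous system and let $g = f_k\circ f_{k-1}\circ\cdots\circ f_1$. If $(X, f_{1,\infty})$ has the strong specification property (SSP), then the autonomous system $(X,g)$ also has SSP.
   Context: A non-autonomous (discrete) system $(X,f_{1,\infty})$ consists of a compact metric space $(X,d)$ and a sequence $f_{1,\infty}=(f_n)_{n\ge 1}$ of continuous surjective maps $f_n:X\to X$. Write $\mathbb{N}=\{1,2,\dots\}$, $f_1^0=\mathrm{id}$ and $f_1^n=f_n\circ\cdots\circ f_1$ for $n\ge1$. An autonomous system $(X,g)$ is the case $f_n=g$ for all $n$ (so $f_1^n=g^n$). The system is $k$-periodic ($k\in\mathbb{N}$) if $f_{n+k}(x)=f_n(x)$ for all $x\in X$, $n\in\mathbb{N}$. A point $z$ is periodic with period $p\in\mathbb{N}$ if $f_1^{pm}(z)=z$ for every $m\in\mathbb{N}$ ($p$ need not be minimal). $(X,f_{1,\infty})$ has the strong specification property (SSP) if for every $\epsilon>0$ there is a positive integer $M(\epsilon)$ such that for every $s\in\mathbb{N}$, every choice of points $x_1,\dots,x_s\in X$, every sequence $a_1\le b_1<a_2\le b_2<\cdots<a_s\le b_s$ of non-negative integers with $a_j-b_{j-1}>M(\epsilon)$ for $2\le j\le s$, and every integer $p>M(\epsilon)+b_s-a_1$, there is a periodic point $z\in X$ with period $p$ such that $d(f_1^j(z),f_1^j(x_i))<\epsilon$ for all $a_i\le j\le b_i$, $1\le i\le s$. *)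

theory Defs
  imports Complex_Main
begin

text \<open>A sequence \<open>f\<^sub>1, f\<^sub>2, \<dots>\<close> of self-maps of \<open>X\<close> is a function on \<open>nat\<close> whose value at \<open>0\<close> is
  never used; each map matters only through its restriction to \<open>X\<close>.\<close>

definition nonautonomous_system :: "'a::metric_space set \<Rightarrow> (nat \<Rightarrow> 'a \<Rightarrow> 'a) \<Rightarrow> bool" where
  "nonautonomous_system X f \<longleftrightarrow>
     compact X \<and> (\<forall>n\<ge>1. continuous_on X (f n) \<and> f n ` X = X)"

text \<open>\<open>iter f n\<close> is \<open>f\<^sub>n \<circ> \<dots> \<circ> f\<^sub>1\<close>.\<close>

primrec iter :: "(nat \<Rightarrow> 'a \<Rightarrow> 'a) \<Rightarrow> nat \<Rightarrow> 'a \<Rightarrow> 'a" where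
  "iter f 0 = id"
| "iter f (Suc n) = f (Suc n) \<circ> iter f n"

definition autonomous :: "('a \<Rightarrow> 'a) \<Rightarrow> nat \<Rightarrow> 'a \<Rightarrow> 'a" where
  "autonomous g = (\<lambda>n. g)"

definition periodic_system :: "nat \<Rightarrow> 'a set \<Rightarrow> (nat \<Rightarrow> 'a \<Rightarrow> 'a) \<Rightarrow> bool" where
  "periodic_system k X f \<longleftrightarrow> k \<ge> 1 \<and> (\<forall>x\<in>X. \<forall>n\<ge>1. f (n + k) x = f n x)"

definition periodic_point :: "'a set \<Rightarrow> (nat \<Rightarrow> 'a \<Rightarrow> 'a) \<Rightarrow> nat \<Rightarrow> 'a \<Rightarrow> bool" where
  "periodic_point X f p z \<longleftrightarrow> z \<in> X \<and> p \<ge> 1 \<and> (\<forall>m\<ge>1. iter f (p * m) z = z)"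

text \<open>The families \<open>x\<close>, \<open>a\<close>, \<open>b\<close> are indexed by \<open>1, \<dots>, s\<close>. No subtraction on \<open>nat\<close> below
  truncates, since \<open>b (j - 1) < a j\<close> and \<open>a 1 \<le> b s\<close> under the hypotheses.\<close>

definition SSP :: "'a::metric_space set \<Rightarrow> (nat \<Rightarrow> 'a \<Rightarrow> 'a) \<Rightarrow> bool" where
  "SSP X f \<longleftrightarrow>
     (\<forall>\<epsilon>>0. \<exists>M::nat. M > 0 \<and>
       (\<forall>s\<ge>1. \<forall>(x :: nat \<Rightarrow> 'a) (a :: nat \<Rightarrow> nat) (b :: nat \<Rightarrow> nat) p.
          (\<forall>i\<in>{1..s}. x i \<in> X) \<longrightarrow>
          (\<forall>i\<in>{1..s}. a i \<le> b i) \<longrightarrow>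
          (\<forall>j\<in>{2..s}. b (j - 1) < a j \<and> a j - b (j - 1) > M) \<longrightarrow>
          p > M + b s - a 1 \<longrightarrow>
          (\<exists>z. periodic_point X f p z \<and>
             (\<forall>i\<in>{1..s}. \<forall>j\<in>{a i..b i}. dist (iter f j z) (iter f j (x i)) < \<epsilon>))))"

end

theory Submission
  imports Defs
begin

lemma iter_in:
  assumes "nonautonomous_system X f" "x \<in> X"
  shows "iter f n x \<in> X"
proof (induction n)
  case (Suc n)
  have "f (Suc n) ` X = X"
    using assms(1) by (simp add: nonautonomous_system_def)
  with Suc show ?case by auto
qed (simp add: assms(2))

lemma periodic_system_shift:
  assumes "periodic_system k X f" "x \<in> X" "n \<ge> 1"
  shows "f (n + k * q) x = f n x"
proof (induction q)
  case (Suc q)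
  have "f ((n + k * q) + k) x = f (n + k * q) x"
    using assms by (simp add: periodic_system_def)
  with Suc show ?case by (simp add: algebra_simps)
qed simp

text \<open>After \<open>k * q\<close> maps the sequence starts afresh, so the next \<open>m\<close>
  maps act as \<open>f 1\<close>, ..., \<open>f m\<close>. Periodicity is only known at points of
  \<open>X\<close>, hence the appeal to \<open>iter_in\<close> for each intermediate point of the
  orbit.\<close>

lemma iter_add_period:
  assumes "nonautonomous_system X f" "periodic_system k X f" "x \<in> X"
  shows "iter f (m + k * q) x = iter f m (iter f (k * q) x)"
proof (induction m)
  case (Suc m)
  have "iter f m (iter f (k * q) x) \<in> X"
    using assms by (intro iter_in)
  then have "f (Suc m + k * q) (iter f m (iter f (k * q) x)) = f (Suc m) (iter f m (iter f (k * q) x))"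
    using assms(2) by (intro periodic_system_shift) auto
  with Suc show ?case by simp
qed simp

text \<open>One more application of \<open>iter f k\<close> appends one more block of
  \<open>k\<close> maps: this is \<open>iter_add_period\<close> with \<open>m = k\<close> and
  \<open>q = n\<close>.\<close>

lemma iter_autonomous_period:
  assumes "nonautonomous_system X f" "periodic_system k X f" "x \<in> X"
  shows "iter (autonomous (iter f k)) n x = iter f (k * n) x"
proof (induction n)
  case (Suc n)
  then show ?case
    using iter_add_period[OF assms, of k n] by (simp add: autonomous_def)
qed simp

text \<open>Since \<open>g\<^sup>n = f\<^sub>1\<^bsup>kn\<^esup>\<close>, multiplying all times by \<open>k \<ge> 1\<close> turns a specification for \<open>g\<close>
  into one for \<open>f\<close>; gaps only grow, so the same \<open>M\<close> works.\<close>

theorem theorem3p1: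
  fixes X :: "'a::metric_space set" and f :: "nat \<Rightarrow> 'a \<Rightarrow> 'a" and g :: "'a \<Rightarrow> 'a" and k :: nat
  assumes "nonautonomous_system X f"
    and "periodic_system k X f"
    and "g = iter f k"
    and "SSP X f"
  shows "SSP X (autonomous g)"
  unfolding SSP_def
proof (intro allI impI)
  fix \<epsilon> :: real
  assume "\<epsilon> > 0"
  from assms(4)[unfolded SSP_def, THEN spec, THEN mp, OF this]
  obtain M where "M > 0" and
    M: "\<forall>s\<ge>1. \<forall>(x :: nat \<Rightarrow> 'a) (a :: nat \<Rightarrow> nat) (b :: nat \<Rightarrow> nat) p.
      (\<forall>i\<in>{1..s}. x i \<in> X) \<longrightarrow> (\<forall>i\<in>{1..s}. a i \<le> b i) \<longrightarrow>
      (\<forall>j\<in>{2..s}. b (j - 1) < a j \<and> a j - b (j - 1) > M) \<longrightarrow> p > M + b s - a 1 \<longrightarrow>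
      (\<exists>z. periodic_point X f p z \<and>
        (\<forall>i\<in>{1..s}. \<forall>j\<in>{a i..b i}. dist (iter f j z) (iter f j (x i)) < \<epsilon>))"
    by (elim exE conjE) (rule that)
  have k: "k \<ge> 1"
    using assms(2) by (simp add: periodic_system_def)
  \<comment> \<open>Multiplying by \<open>k\<close> gives \<open>k * M + k * u < k * v\<close>, and
    \<open>k * M\<close> may be lowered to \<open>M\<close>. The additive form keeps clear of
    truncated subtraction and serves both the gaps and the period bound.\<close>
  have scale: "M + k * u < k * v" if "M + u < v" for u v
  proof -
    have "M \<le> k * M" using k by simp
    moreover have "k * (M + u) < k * v" using that k by simp
    ultimately show ?thesis unfolding distrib_left by linarith
  qed
  have iter_g: "iter (autonomous g) n x = iter f (k * n) x" if "x \<in> X" for n x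
    using iter_autonomous_period[OF assms(1,2) that] assms(3) by simp
  show "\<exists>M>0. \<forall>s\<ge>1. \<forall>(x :: nat \<Rightarrow> 'a) (a :: nat \<Rightarrow> nat) (b :: nat \<Rightarrow> nat) p.
      (\<forall>i\<in>{1..s}. x i \<in> X) \<longrightarrow> (\<forall>i\<in>{1..s}. a i \<le> b i) \<longrightarrow>
      (\<forall>j\<in>{2..s}. b (j - 1) < a j \<and> M < a j - b (j - 1)) \<longrightarrow> M + b s - a 1 < p \<longrightarrow>
      (\<exists>z. periodic_point X (autonomous g) p z \<and>
        (\<forall>i\<in>{1..s}. \<forall>j\<in>{a i..b i}.
          dist (iter (autonomous g) j z) (iter (autonomous g) j (x i)) < \<epsilon>))"
  proof (intro exI[of _ M] conjI \<open>M > 0\<close> allI impI)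
    fix s :: nat and x :: "nat \<Rightarrow> 'a" and a b :: "nat \<Rightarrow> nat" and p :: nat
    assume s: "1 \<le> s" and x: "\<forall>i\<in>{1..s}. x i \<in> X" and ab: "\<forall>i\<in>{1..s}. a i \<le> b i"
      and gap: "\<forall>j\<in>{2..s}. b (j - 1) < a j \<and> M < a j - b (j - 1)"
      and p: "M + b s - a 1 < p"
    have "k * b (j - 1) < k * a j \<and> M < k * a j - k * b (j - 1)" if "j \<in> {2..s}" for j
    proof -
      have "M + b (j - 1) < a j" using gap that by (simp add: less_diff_conv)
      from scale[OF this] show ?thesis by linarith
    qed
    moreover have "M + k * b s - k * a 1 < k * p"
    proof -
      \<comment> \<open>Moving \<open>a 1\<close> to the right puts the period bound in the form
        required by \<open>scale\<close>, with \<open>v = p + a 1\<close>.\<close>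
      have "M + b s < p + a 1" using p by linarith
      from scale[OF this] have "M + k * b s < k * p + k * a 1" by (simp add: algebra_simps)
      \<comment> \<open>Positivity settles the case in which the subtraction of
        \<open>k * a 1\<close> on \<open>nat\<close> would truncate to \<open>0\<close>.\<close>
      moreover have "0 < k * p" using k p by simp
      ultimately show ?thesis by linarith
    qed
    moreover have "\<forall>i\<in>{1..s}. k * a i \<le> k * b i"
      using ab by simp
    ultimately obtain z where z: "periodic_point X f (k * p) z"
      and close: "\<forall>i\<in>{1..s}. \<forall>j\<in>{k * a i..k * b i}. dist (iter f j z) (iter f j (x i)) < \<epsilon>"
      using M[THEN spec, THEN mp, OF s, THEN spec, THEN spec, THEN spec, THEN spec, THEN mp,
          OF x, of "\<lambda>i. k * a i" "\<lambda>i. k * b i" "k * p"]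
      by blast
    have zX: "z \<in> X" using z by (simp add: periodic_point_def)
    \<comment> \<open>The point \<open>z\<close> returns under \<open>f\<close> at the times
      \<open>k * p * m\<close>, which are the times \<open>p * m\<close> for \<open>g\<close>;
      \<open>mult.assoc\<close> regroups the product.\<close>
    have "periodic_point X (autonomous g) p z"
      using z p iter_g[OF zX] by (auto simp: periodic_point_def mult.assoc)
    moreover have "dist (iter (autonomous g) j z) (iter (autonomous g) j (x i)) < \<epsilon>"
      if "i \<in> {1..s}" "j \<in> {a i..b i}" for i j
      \<comment> \<open>Time \<open>j\<close> for \<open>g\<close> is time \<open>k * j\<close> for
        \<open>f\<close>, which lies between \<open>k * a i\<close> and \<open>k * b i\<close>; only
        these multiples of \<open>k\<close> in the longer interval are used.\<close>
      using that close x by (simp add: iter_g zX)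
    ultimately show "\<exists>z. periodic_point X (autonomous g) p z \<and>
        (\<forall>i\<in>{1..s}. \<forall>j\<in>{a i..b i}.
          dist (iter (autonomous g) j z) (iter (autonomous g) j (x i)) < \<epsilon>)"
      by blast
  qed
qed

end
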